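(* Let $\Bbbk$ be a field. (1) A $\Bbbk$-linear graded unital Leibniz algebra $(V,[,],\nu)$ with a Lie character $\epsilon$ can be endowed with the degree $-1$ tensor differential $${}^{\epsilon}d(v_1\ldots v_n)=\sum_{1\le i<j\le n}(-1)^{j-1+\alpha_{i,j}}v_1\ldots v_{i-1}[v_i,v_j]v_{i+1}\ldots\widehat{v_j}\ldots v_n+\sum_{1\le j\le n}(-1)^{j-1+\alpha_{0,j}}\epsilon(v_j)v_1\ldots\widehat{v_j}\ldots v_n,$$ where $\alpha_{i,j}:=\deg(v_j)\sum_{i<k<j}\deg(v_k)$. (2) A $\Bbbk$-linear graded Leibniz algebra $(V,[,])$ with a non-unital Lie character $\epsilon$ can be endowed with the degree $-1$ tensor differential $${}^{\epsilon}d(v_1\ldots v_n)=\sum_{1\le i<j\le n}(-1)^{j-1+\alpha_{i,j}}v_1\ldots v_{i-1}[v_i,v_j]v_{i+1}\ldots\widehat{v_j}\ldots v_n.$$ All the $v_i$'s are taken homogeneous here.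
   Context: $v_1\ldots v_n$ denotes $v_1\otimes\cdots\otimes v_n\in V^{\otimes n}$. A graded Leibniz algebra is a $\mathbb Z$-graded $\Bbbk$-vector space $V$ with a degree-preserving bilinear bracket satisfying $[v,[w,u]]=[[v,w],u]-(-1)^{\deg u\deg w}[[v,u],w]$ for homogeneous $v,w,u$; it is unital if endowed with a degree-preserving map $\nu:\Bbbk\to V$ (with $\Bbbk$ in degree $0$), i.e. an element $\mathbf 1=\nu(1)\in V_0$, such that $[\mathbf 1,v]=[v,\mathbf 1]=0$ for all $v$. A non-unital Lie character is a degree-preserving linear map $\epsilon:V\to\Bbbk$ (thus vanishing outside $V_0$) with $\epsilon([v,w])=0$ for all $v,w$; a Lie character for a unital one moreover satisfies $\epsilon(\mathbf 1)=1$. A degree $-1$ tensor differential for $V$ is a family of (degree-preserving, for the internal grading) linear maps $d_n:V^{\otimes n}\to V^{\otimes(n-1)}$, $n>0$, with $d_{n-1}\circ d_n=0$ for all $n>1$. *)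

theory Defs
  imports Complex_Main "HOL-Library.Poly_Mapping"
begin

section \<open>Graded Leibniz algebras and Lie characters\<close>

locale graded_vector_space = vector_space scale
  for scale :: "'k::field \<Rightarrow> 'v::ab_group_add \<Rightarrow> 'v" (infixr \<open>*s\<close> 75) +
  fixes V :: "int \<Rightarrow> 'v set"
  assumes subspace_V: "subspace (V m)"
    and direct_sum: "\<exists>!c :: int \<Rightarrow> 'v. (\<forall>m. c m \<in> V m) \<and> finite {m. c m \<noteq> 0} \<and>
                       v = (\<Sum>m | c m \<noteq> 0. c m)"

text \<open>Signs \<open>(-1)\<^sup>m\<close> with a possibly negative exponent are elements of the field.\<close>

definition sign :: "int \<Rightarrow> 'k::field" where
  "sign m = (-1) powi m"

locale graded_leibniz_algebra = graded_vector_space scale V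
  for scale :: "'k::field \<Rightarrow> 'v::ab_group_add \<Rightarrow> 'v" (infixr \<open>*s\<close> 75)
    and V :: "int \<Rightarrow> 'v set" +
  fixes br :: "'v \<Rightarrow> 'v \<Rightarrow> 'v"
  assumes linear_left: "Vector_Spaces.linear scale scale (\<lambda>v. br v w)"
    and linear_right: "Vector_Spaces.linear scale scale (\<lambda>w. br v w)"
    and degree: "v \<in> V a \<Longrightarrow> w \<in> V b \<Longrightarrow> br v w \<in> V (a + b)"
    and leibniz: "v \<in> V a \<Longrightarrow> w \<in> V b \<Longrightarrow> u \<in> V c \<Longrightarrow>
                    br v (br w u) = br (br v w) u - sign (c * b) *s br (br v u) w"

locale graded_unital_leibniz_algebra = graded_leibniz_algebra scale V br
  for scale :: "'k::field \<Rightarrow> 'v::ab_group_add \<Rightarrow> 'v" (infixr \<open>*s\<close> 75)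
    and V :: "int \<Rightarrow> 'v set" and br :: "'v \<Rightarrow> 'v \<Rightarrow> 'v" +
  fixes \<nu> :: "'k \<Rightarrow> 'v"
  assumes unit_linear: "Vector_Spaces.linear (*) scale \<nu>"
    and unit_degree: "\<nu> x \<in> V 0"
    and unit_left: "br (\<nu> 1) v = 0"
    and unit_right: "br v (\<nu> 1) = 0"

definition nonunital_lie_character ::
  "('k::field \<Rightarrow> 'v::ab_group_add \<Rightarrow> 'v) \<Rightarrow> (int \<Rightarrow> 'v set) \<Rightarrow> ('v \<Rightarrow> 'v \<Rightarrow> 'v) \<Rightarrow> ('v \<Rightarrow> 'k) \<Rightarrow> bool"
  where "nonunital_lie_character scale V br \<epsilon> \<longleftrightarrow>
    Vector_Spaces.linear scale (*) \<epsilon> \<and>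
    (\<forall>m v. m \<noteq> 0 \<longrightarrow> v \<in> V m \<longrightarrow> \<epsilon> v = 0) \<and>
    (\<forall>v w. \<epsilon> (br v w) = 0)"

definition lie_character ::
  "('k::field \<Rightarrow> 'v::ab_group_add \<Rightarrow> 'v) \<Rightarrow> (int \<Rightarrow> 'v set) \<Rightarrow> ('v \<Rightarrow> 'v \<Rightarrow> 'v) \<Rightarrow> ('k \<Rightarrow> 'v) \<Rightarrow>
   ('v \<Rightarrow> 'k) \<Rightarrow> bool"
  where "lie_character scale V br \<nu> \<epsilon> \<longleftrightarrow> nonunital_lie_character scale V br \<epsilon> \<and> \<epsilon> (\<nu> 1) = 1"


section \<open>Tensor powers\<close>

text \<open>
  The tensor power of order \<open>n\<close> is the free vector space on \<open>V\<^sup>n\<close> (lists of length \<open>n\<close>) modulo the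
  span of the multilinearity relations.  Its elements are cosets, i.e. equivalence classes of
  formal linear combinations.
\<close>

type_synonym ('k, 'v) formal = "'v list \<Rightarrow>\<^sub>0 'k"
type_synonym ('k, 'v) tensor = "('v list \<Rightarrow>\<^sub>0 'k) set"

definition fscale :: "'k::field \<Rightarrow> ('k, 'v) formal \<Rightarrow> ('k, 'v) formal" where
  "fscale c f = Poly_Mapping.map ((*) c) f"

lemma lookup_fscale [simp]: "Poly_Mapping.lookup (fscale c f) x = c * Poly_Mapping.lookup f x"
  by (simp add: fscale_def Poly_Mapping.map.rep_eq when_def)

global_interpretation formal: vector_space fscale
  by unfold_locales (auto intro!: poly_mapping_eqI simp: lookup_add algebra_simps)

definition word :: "'v list \<Rightarrow> ('k::field, 'v) formal" where
  "word vs = Poly_Mapping.single vs 1"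

definition formal_power :: "nat \<Rightarrow> ('k::field, 'v) formal set" where
  "formal_power n = {f. Poly_Mapping.keys f \<subseteq> {vs. length vs = n}}"

definition multilinear_relations ::
  "('k::field \<Rightarrow> 'v::ab_group_add \<Rightarrow> 'v) \<Rightarrow> nat \<Rightarrow> ('k, 'v) formal set" where
  "multilinear_relations scale n =
     {word (xs @ (v + w) # ys) - word (xs @ v # ys) - word (xs @ w # ys) | xs v w ys.
        length xs + 1 + length ys = n} \<union>
     {word (xs @ scale c v # ys) - fscale c (word (xs @ v # ys)) | xs c v ys.
        length xs + 1 + length ys = n}"

definition tensor_rel ::
  "('k::field \<Rightarrow> 'v::ab_group_add \<Rightarrow> 'v) \<Rightarrow> nat \<Rightarrow> (('k, 'v) formal \<times> ('k, 'v) formal) set" where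
  "tensor_rel scale n = {(f, g). f \<in> formal_power n \<and> g \<in> formal_power n \<and>
                                 f - g \<in> formal.span (multilinear_relations scale n)}"

definition tensor_power ::
  "('k::field \<Rightarrow> 'v::ab_group_add \<Rightarrow> 'v) \<Rightarrow> nat \<Rightarrow> ('k, 'v) tensor set" where
  "tensor_power scale n = formal_power n // tensor_rel scale n"

definition tensor_class ::
  "('k::field \<Rightarrow> 'v::ab_group_add \<Rightarrow> 'v) \<Rightarrow> nat \<Rightarrow> ('k, 'v) formal \<Rightarrow> ('k, 'v) tensor" where
  "tensor_class scale n f = tensor_rel scale n `` {f}"

definition pure_tensor ::
  "('k::field \<Rightarrow> 'v::ab_group_add \<Rightarrow> 'v) \<Rightarrow> 'v list \<Rightarrow> ('k, 'v) tensor" where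
  "pure_tensor scale vs = tensor_class scale (length vs) (word vs)"

text \<open>The unions below are over equal sets; see \<open>tensor_add_class\<close> and \<open>tensor_scale_class\<close>.\<close>

definition tensor_add ::
  "('k::field \<Rightarrow> 'v::ab_group_add \<Rightarrow> 'v) \<Rightarrow> nat \<Rightarrow>
   ('k, 'v) tensor \<Rightarrow> ('k, 'v) tensor \<Rightarrow> ('k, 'v) tensor" where
  "tensor_add scale n A B = (\<Union>f\<in>A. \<Union>g\<in>B. tensor_class scale n (f + g))"

definition tensor_scale ::
  "('k::field \<Rightarrow> 'v::ab_group_add \<Rightarrow> 'v) \<Rightarrow> nat \<Rightarrow> 'k \<Rightarrow> ('k, 'v) tensor \<Rightarrow> ('k, 'v) tensor" where
  "tensor_scale scale n c A = (\<Union>f\<in>A. tensor_class scale n (fscale c f))"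

definition tensor_zero ::
  "('k::field \<Rightarrow> 'v::ab_group_add \<Rightarrow> 'v) \<Rightarrow> nat \<Rightarrow> ('k, 'v) tensor" where
  "tensor_zero scale n = tensor_class scale n 0"

lemma formal_power_zero: "0 \<in> formal_power n"
  by (simp add: formal_power_def)

lemma formal_power_add:
  "f \<in> formal_power n \<Longrightarrow> g \<in> formal_power n \<Longrightarrow> f + g \<in> formal_power n"
  unfolding formal_power_def using keys_add[of f g] by blast

lemma formal_power_scale: "f \<in> formal_power n \<Longrightarrow> fscale c f \<in> formal_power n"
  by (auto simp: formal_power_def in_keys_iff subset_iff)

lemma formal_power_word: "length vs = n \<Longrightarrow> word vs \<in> formal_power n"
  by (simp add: formal_power_def word_def)

lemma equiv_tensor_rel: "equiv (formal_power n) (tensor_rel scale n)"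
proof (rule equivI)
  show "tensor_rel scale n \<subseteq> formal_power n \<times> formal_power n"
    by (auto simp: tensor_rel_def)
  show "refl_on (formal_power n) (tensor_rel scale n)"
    by (auto simp: refl_on_def tensor_rel_def formal.span_zero)
  show "sym (tensor_rel scale n)"
  proof (rule symI)
    fix f g assume "(f, g) \<in> tensor_rel scale n"
    then show "(g, f) \<in> tensor_rel scale n"
      using formal.span_neg[of "f - g"] by (simp add: tensor_rel_def)
  qed
  show "trans (tensor_rel scale n)"
  proof (rule transI)
    fix f g h assume "(f, g) \<in> tensor_rel scale n" "(g, h) \<in> tensor_rel scale n"
    then show "(f, h) \<in> tensor_rel scale n"
      using formal.span_add[of "f - g" _ "g - h"] by (simp add: tensor_rel_def)
  qed
qed

lemma tensor_class_eq_iff: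
  assumes "f \<in> formal_power n" "g \<in> formal_power n"
  shows "tensor_class scale n f = tensor_class scale n g \<longleftrightarrow>
         f - g \<in> formal.span (multilinear_relations scale n)"
proof -
  have "tensor_class scale n f = tensor_class scale n g \<longleftrightarrow> (f, g) \<in> tensor_rel scale n"
    unfolding tensor_class_def using assms by (rule eq_equiv_class_iff[OF equiv_tensor_rel])
  then show ?thesis using assms by (simp add: tensor_rel_def)
qed

lemma tensor_class_self: "f \<in> formal_power n \<Longrightarrow> f \<in> tensor_class scale n f"
  unfolding tensor_class_def by (rule equiv_class_self[OF equiv_tensor_rel])

lemma tensor_classD:
  "g \<in> tensor_class scale n f \<Longrightarrow>
   g \<in> formal_power n \<and> f - g \<in> formal.span (multilinear_relations scale n)"
  by (auto simp: tensor_class_def tensor_rel_def)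

lemma tensor_add_class:
  assumes "f \<in> formal_power n" "g \<in> formal_power n"
  shows "tensor_add scale n (tensor_class scale n f) (tensor_class scale n g) =
         tensor_class scale n (f + g)"
proof -
  have eq: "tensor_class scale n (f' + g') = tensor_class scale n (f + g)"
    if "f' \<in> tensor_class scale n f" "g' \<in> tensor_class scale n g" for f' g'
  proof -
    have "(f + g) - (f' + g') \<in> formal.span (multilinear_relations scale n)"
      unfolding add_diff_add
      by (rule formal.span_add) (use that[THEN tensor_classD] in simp_all)
    moreover have "f + g \<in> formal_power n" "f' + g' \<in> formal_power n"
      using assms that[THEN tensor_classD] by (simp_all add: formal_power_add)
    ultimately show ?thesis
      using tensor_class_eq_iff by blast
  qed
  have "tensor_add scale n (tensor_class scale n f) (tensor_class scale n g) =
        (\<Union>f'\<in>tensor_class scale n f. \<Union>g'\<in>tensor_class scale n g. tensor_class scale n (f + g))"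
    unfolding tensor_add_def by (intro SUP_cong refl eq)
  moreover have "tensor_class scale n f \<noteq> {}" "tensor_class scale n g \<noteq> {}"
    using assms tensor_class_self by (metis empty_iff)+
  ultimately show ?thesis by simp
qed

lemma tensor_scale_class:
  assumes "f \<in> formal_power n"
  shows "tensor_scale scale n c (tensor_class scale n f) = tensor_class scale n (fscale c f)"
proof -
  have eq: "tensor_class scale n (fscale c f') = tensor_class scale n (fscale c f)"
    if "f' \<in> tensor_class scale n f" for f'
  proof -
    have "fscale c f - fscale c f' \<in> formal.span (multilinear_relations scale n)"
      unfolding formal.scale_right_diff_distrib[symmetric]
      using formal.span_scale that[THEN tensor_classD] by blast
    moreover have "fscale c f \<in> formal_power n" "fscale c f' \<in> formal_power n"
      using assms that[THEN tensor_classD] by (simp_all add: formal_power_scale)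
    ultimately show ?thesis
      using tensor_class_eq_iff by blast
  qed
  have "tensor_scale scale n c (tensor_class scale n f) =
        (\<Union>f'\<in>tensor_class scale n f. tensor_class scale n (fscale c f))"
    unfolding tensor_scale_def by (intro SUP_cong refl eq)
  moreover have "tensor_class scale n f \<noteq> {}"
    using assms tensor_class_self by (metis empty_iff)
  ultimately show ?thesis by simp
qed

lemma pure_tensor_add:
  "pure_tensor scale (xs @ (v + w) # ys) =
   tensor_add scale (length xs + 1 + length ys)
     (pure_tensor scale (xs @ v # ys)) (pure_tensor scale (xs @ w # ys))"
proof -
  let ?n = "length xs + 1 + length ys"
  have "word (xs @ (v + w) # ys) - (word (xs @ v # ys) + word (xs @ w # ys))
          \<in> multilinear_relations scale ?n"
    unfolding multilinear_relations_def diff_diff_add[symmetric] by blast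
  then show ?thesis
    by (simp add: pure_tensor_def tensor_add_class tensor_class_eq_iff formal_power_word
        formal_power_add formal.span_base)
qed

lemma pure_tensor_scale:
  "pure_tensor scale (xs @ scale c v # ys) =
   tensor_scale scale (length xs + 1 + length ys) c (pure_tensor scale (xs @ v # ys))"
proof -
  let ?n = "length xs + 1 + length ys"
  have "word (xs @ scale c v # ys) - fscale c (word (xs @ v # ys))
          \<in> multilinear_relations scale ?n"
    unfolding multilinear_relations_def by blast
  then show ?thesis
    by (simp add: pure_tensor_def tensor_scale_class tensor_class_eq_iff formal_power_word
        formal_power_scale formal.span_base)
qed


section \<open>Tensor differentials\<close>

definition homogeneous :: "(int \<Rightarrow> 'v set) \<Rightarrow> int list \<Rightarrow> 'v list \<Rightarrow> bool" where
  "homogeneous V ds vs \<longleftrightarrow> list_all2 (\<lambda>d v. v \<in> V d) ds vs"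

text \<open>
  The component of internal degree \<open>m\<close> of the \<open>n\<close>-th tensor power is spanned by the tensors of
  homogeneous vectors with total degree \<open>m\<close>.
\<close>

definition tensor_component ::
  "('k::field \<Rightarrow> 'v::ab_group_add \<Rightarrow> 'v) \<Rightarrow> (int \<Rightarrow> 'v set) \<Rightarrow> nat \<Rightarrow> int \<Rightarrow> ('k, 'v) tensor set" where
  "tensor_component scale V n m =
     tensor_class scale n `
       formal.span {word vs | vs ds. length vs = n \<and> homogeneous V ds vs \<and> sum_list ds = m}"

definition tensor_linear ::
  "('k::field \<Rightarrow> 'v::ab_group_add \<Rightarrow> 'v) \<Rightarrow> nat \<Rightarrow> nat \<Rightarrow>
   (('k, 'v) tensor \<Rightarrow> ('k, 'v) tensor) \<Rightarrow> bool" where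
  "tensor_linear scale n m h \<longleftrightarrow>
     (\<forall>A\<in>tensor_power scale n. h A \<in> tensor_power scale m) \<and>
     (\<forall>A\<in>tensor_power scale n. \<forall>B\<in>tensor_power scale n.
        h (tensor_add scale n A B) = tensor_add scale m (h A) (h B)) \<and>
     (\<forall>c. \<forall>A\<in>tensor_power scale n. h (tensor_scale scale n c A) = tensor_scale scale m c (h A))"

definition tensor_differential ::
  "('k::field \<Rightarrow> 'v::ab_group_add \<Rightarrow> 'v) \<Rightarrow> (int \<Rightarrow> 'v set) \<Rightarrow>
   (nat \<Rightarrow> ('k, 'v) tensor \<Rightarrow> ('k, 'v) tensor) \<Rightarrow> bool" where
  "tensor_differential scale V d \<longleftrightarrow>
     (\<forall>n>0. tensor_linear scale n (n - 1) (d n) \<and>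
            (\<forall>m. d n ` tensor_component scale V n m \<subseteq> tensor_component scale V (n - 1) m)) \<and>
     (\<forall>n>1. \<forall>A\<in>tensor_power scale n. d (n - 1) (d n A) = tensor_zero scale (n - 2))"

text \<open>Positions \<open>i\<close>, \<open>j\<close> are counted from \<open>1\<close>, so \<open>v\<^sub>i\<close> is \<open>vs ! (i - 1)\<close>.\<close>

definition omit :: "nat \<Rightarrow> 'a list \<Rightarrow> 'a list" where
  "omit j xs = take (j - 1) xs @ drop j xs"

definition alpha :: "int list \<Rightarrow> nat \<Rightarrow> nat \<Rightarrow> int" where
  "alpha ds i j = ds ! (j - 1) * (\<Sum>k\<in>{i<..<j}. ds ! (k - 1))"

text \<open>
  The two sums of the differential, as formal combinations of words of length \<open>length vs - 1\<close>.
\<close>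

definition bracket_sum ::
  "('v \<Rightarrow> 'v \<Rightarrow> 'v) \<Rightarrow> int list \<Rightarrow> 'v list \<Rightarrow> ('k::field, 'v) formal" where
  "bracket_sum br ds vs =
     (\<Sum>(i, j)\<in>{(i, j). 1 \<le> i \<and> i < j \<and> j \<le> length vs}.
        fscale (sign (int j - 1 + alpha ds i j))
          (word (omit j (vs[i - 1 := br (vs ! (i - 1)) (vs ! (j - 1))]))))"

definition character_sum ::
  "('v \<Rightarrow> 'k::field) \<Rightarrow> int list \<Rightarrow> 'v list \<Rightarrow> ('k, 'v) formal" where
  "character_sum \<epsilon> ds vs =
     (\<Sum>j\<in>{1..length vs}. fscale (sign (int j - 1 + alpha ds 0 j) * \<epsilon> (vs ! (j - 1)))
        (word (omit j vs)))"

end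

theory Submission
  imports Defs
begin

text \<open>
  For a homogeneous vector \<open>w\<close> let \<open>R\<^sub>w\<close> be the operator on words with \<open>R\<^sub>w 1 = \<epsilon> w\<close> on the empty
  word and \<open>R\<^sub>w (x v) = \<plusminus> R\<^sub>w x v + x [v, w]\<close>, the sign being \<open>-1\<close> to the power
  \<open>deg v * deg w\<close>.  Collecting in the formula for the differential \<open>d\<close> the terms that remove
  the last letter gives \<open>d (x w) = d x w \<plusminus> R\<^sub>w x\<close>, the sign being \<open>-1\<close> to the length of \<open>x\<close>.  If \<open>d\<close>
  is multiplied by \<open>-1\<close> to the power \<open>n + 1\<close> on words of length \<open>n\<close>, it becomes an operator \<open>\<delta>\<close> with
  \<open>\<delta> (x w) = R\<^sub>w x - \<delta> x w\<close>, and then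
  \<open>\<delta> (\<delta> (x w)) = \<delta> (R\<^sub>w x) - R\<^sub>w (\<delta> x) + \<delta> (\<delta> x) w\<close>.  So \<open>d\<close> squares to zero once every \<open>R\<^sub>w\<close>
  commutes with \<open>\<delta>\<close>, and the same recursion reduces this to
  \<open>R\<^sub>w R\<^sub>u = \<plusminus> R\<^sub>u R\<^sub>w + R\<close> with the last \<open>R\<close> taken at \<open>[u, w]\<close>: words form a right representation.
  That identity is the Leibniz identity on the last letter; on the empty word it holds because \<open>\<epsilon>\<close>
  kills brackets and all vectors of nonzero degree.

  Tensors are cosets of formal combinations, which are clumsy to compute with.  The
  computation is therefore done on the dual side.  A formal combination \<open>f\<close> of words of one length
  is zero as a tensor if and only if every multilinear functional vanishes on it
  (\<open>pairing_relations\<close>, \<open>relations_if_pairing_zero\<close>), and the transposes of \<open>R\<^sub>w\<close> and \<open>\<delta>\<close> are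
  operators \<open>act\<close> and \<open>codifferential\<close> on functionals with honest equations between
  scalars in place of congruences.  Their three identities are \<open>act_representation\<close>, \<open>codifferential_act\<close> and
  \<open>codifferential_squared\<close>.

  The operators must be defined on functionals of arbitrary words, also of inhomogeneous vectors.
  As the signs depend on parities only, it suffices to split \<open>w\<close> into its even and its odd part
  and to let the odd part act with the parity involution on the letters that it passes.  Then
  \<open>codifferential\<close> preserves multilinearity, which makes the differential well defined on tensors,
  while all identities need to be checked on homogeneous words only, since these generate
  (\<open>formal_power_subset_span\<close>).

  Without a unit the formula has no character terms.  This is the case of the zero character,
  so both claims are instances of one construction; the first one applies it to the given \<open>\<epsilon>\<close>.
\<close>

section \<open>Signs\<close>

lemma sign_add: "(sign (a + b) :: 'k::field) = sign a * sign b"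
  by (simp add: sign_def power_int_add)

lemma sign_square [simp]: "(sign a :: 'k::field) * sign a = 1"
  by (simp add: sign_def flip: power_int_mult_distrib)

lemma sign_square_left [simp]: "(sign a :: 'k::field) * (sign a * x) = x"
  by (simp flip: mult.assoc)

lemma sign_even: "even a \<Longrightarrow> sign a = (1 :: 'k::field)"
  by (auto simp: sign_def power_int_mult elim!: evenE)

lemma sign_odd: "odd a \<Longrightarrow> sign a = (-1 :: 'k::field)"
  by (auto elim!: oddE simp: sign_add sign_even) (simp add: sign_def)

section \<open>Homogeneous components and parity\<close>
definition grade_decomposition ::
  "(int \<Rightarrow> 'v::ab_group_add set) \<Rightarrow> 'v \<Rightarrow> (int \<Rightarrow> 'v) \<Rightarrow> bool" where
  "grade_decomposition V v c \<longleftrightarrow>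
     (\<forall>m. c m \<in> V m) \<and> finite {m. c m \<noteq> 0} \<and> v = (\<Sum>m | c m \<noteq> 0. c m)"

context graded_vector_space
begin

definition component :: "'v \<Rightarrow> int \<Rightarrow> 'v" where
  "component v = (THE c. grade_decomposition V v c)"

lemma grade_decomposition_component: "grade_decomposition V v (component v)"
  unfolding component_def grade_decomposition_def by (rule theI'[OF direct_sum])

lemma component_eqI: "grade_decomposition V v c \<Longrightarrow> component v = c"
  using direct_sum[of v] grade_decomposition_component[of v]
  unfolding grade_decomposition_def by blast

lemma component_linear: "component (c *s v + w) m = c *s component v m + component w m"
proof -
  let ?e = "\<lambda>m. c *s component v m + component w m"
  let ?S = "{m. component v m \<noteq> 0} \<union> {m. component w m \<noteq> 0}"
  note v = grade_decomposition_component[of v, unfolded grade_decomposition_def]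
  note w = grade_decomposition_component[of w, unfolded grade_decomposition_def]
  have fin: "finite ?S" and sub: "{m. ?e m \<noteq> 0} \<subseteq> ?S"
    using v w by auto
  have "(\<Sum>m | ?e m \<noteq> 0. ?e m) = (\<Sum>m\<in>?S. ?e m)"
    using fin sub by (intro sum.mono_neutral_left) auto
  also have "\<dots> = c *s (\<Sum>m\<in>?S. component v m) + (\<Sum>m\<in>?S. component w m)"
    by (simp add: sum.distrib scale_sum_right)
  also have "(\<Sum>m\<in>?S. component v m) = v"
    using v fin by (subst sum.mono_neutral_right[of ?S "{m. component v m \<noteq> 0}"]) auto
  also have "(\<Sum>m\<in>?S. component w m) = w"
    using w fin by (subst sum.mono_neutral_right[of ?S "{m. component w m \<noteq> 0}"]) auto
  finally have "grade_decomposition V (c *s v + w) ?e"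
    unfolding grade_decomposition_def
    using v w finite_subset[OF sub fin] subspace_V
    by (auto intro: subspace_add subspace_scale)
  then show ?thesis by (simp add: component_eqI)
qed

lemma component_homogeneous:
  assumes "v \<in> V a"
  shows "component v = (\<lambda>m. if m = a then v else 0)"
proof (rule component_eqI)
  have "{m. (if m = a then v else 0) \<noteq> 0} = (if v = 0 then {} else {a})" by auto
  then show "grade_decomposition V v (\<lambda>m. if m = a then v else 0)"
    using assms subspace_V by (simp add: grade_decomposition_def subspace_0)
qed

definition even_part :: "'v \<Rightarrow> 'v" where
  "even_part v = (\<Sum>m | component v m \<noteq> 0 \<and> even m. component v m)"

lemma finite_component: "finite {m. component v m \<noteq> 0}"
  using grade_decomposition_component[of v] by (simp add: grade_decomposition_def)

lemma even_part_linear: "even_part (c *s v + w) = c *s even_part v + even_part w"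
proof -
  let ?S = "{m. component v m \<noteq> 0} \<union> {m. component w m \<noteq> 0} \<union> {m. component (c *s v + w) m \<noteq> 0}"
  let ?T = "{m \<in> ?S. even m}"
  have fin: "finite ?T" using finite_component[of v] finite_component[of w]
      finite_component[of "c *s v + w"] by (intro finite_subset[of ?T ?S]) auto
  have *: "even_part u = (\<Sum>m\<in>?T. component u m)" if "{m. component u m \<noteq> 0} \<subseteq> ?S" for u
    unfolding even_part_def by (rule sum.mono_neutral_left[OF fin]) (use that in auto)
  have "even_part (c *s v + w) = (\<Sum>m\<in>?T. c *s component v m + component w m)"
    by (subst *) (auto simp: component_linear)
  also have "\<dots> = c *s even_part v + even_part w"
    by (subst (1 2) *) (auto simp: sum.distrib scale_sum_right)
  finally show ?thesis .
qed

lemma even_part_homogeneous: "v \<in> V a \<Longrightarrow> even_part v = (if even a then v else 0)"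
  unfolding even_part_def component_homogeneous
  by (cases "v = 0") (auto simp: if_distrib cong: conj_cong if_cong
    intro!: trans[OF sum.cong[where B = "{a}"]] sum.neutral)

text \<open>
  Defined as a complement, not as a sum over odd degrees, so that linearity is inherited from the even part.
\<close>
definition odd_part :: "'v \<Rightarrow> 'v" where
  "odd_part v = v - even_part v"

definition parity_involution :: "'v \<Rightarrow> 'v" where
  "parity_involution v = even_part v - odd_part v"

lemma odd_part_linear: "odd_part (c *s v + w) = c *s odd_part v + odd_part w"
  by (simp add: odd_part_def even_part_linear scale_right_diff_distrib)

lemma parity_involution_linear:
  "parity_involution (c *s v + w) = c *s parity_involution v + parity_involution w"
  by (simp add: parity_involution_def even_part_linear odd_part_linear scale_right_diff_distrib)

lemma odd_part_homogeneous: "v \<in> V a \<Longrightarrow> odd_part v = (if even a then 0 else v)"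
  by (simp add: odd_part_def even_part_homogeneous)

lemma parity_involution_homogeneous: "v \<in> V a \<Longrightarrow> parity_involution v = sign a *s v"
  by (simp add: parity_involution_def even_part_homogeneous odd_part_homogeneous sign_even sign_odd)

section \<open>Multilinear functionals on words\<close>

text \<open>
  One function on words of all lengths stands for a family of multilinear forms, one on each
  Cartesian power.  The single combined equation says additivity and homogeneity at once, which
  halves the inductions below.
\<close>
definition multilinear :: "('v list \<Rightarrow> 'k) \<Rightarrow> bool" where
  "multilinear F \<longleftrightarrow> (\<forall>xs c v w ys.
     F (xs @ (c *s v + w) # ys) = c * F (xs @ v # ys) + F (xs @ w # ys))"

lemma multilinearD:
  "multilinear F \<Longrightarrow> F (xs @ (c *s v + w) # ys) = c * F (xs @ v # ys) + F (xs @ w # ys)"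
  unfolding multilinear_def by blast

lemma multilinear_hd:
  "multilinear F \<Longrightarrow> F ((c *s v + w) # ys) = c * F (v # ys) + F (w # ys)"
  using multilinearD[of F "[]"] by simp

lemma multilinear_add:
  "multilinear F \<Longrightarrow> F (xs @ (v + w) # ys) = F (xs @ v # ys) + F (xs @ w # ys)"
  using multilinearD[of F xs 1 v w ys] by simp

lemma multilinear_zero: "multilinear F \<Longrightarrow> F (xs @ 0 # ys) = 0"
  by (metis add_0 add_cancel_right_right multilinear_add)

lemma multilinear_scale: "multilinear F \<Longrightarrow> F (xs @ (c *s v) # ys) = c * F (xs @ v # ys)"
  using multilinearD[of F xs c v 0 ys] multilinear_zero[of F xs ys] by simp

lemma multilinear_slot: "multilinear F \<Longrightarrow> multilinear (\<lambda>rs. F (v # rs))"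
  unfolding multilinear_def by (metis append_Cons)

lemma multilinear_combination:
  "multilinear F \<Longrightarrow> multilinear H \<Longrightarrow> multilinear (\<lambda>xs. c * F xs + H xs)"
  unfolding multilinear_def by (auto simp: algebra_simps)

lemma multilinear_rev: "multilinear F \<Longrightarrow> multilinear (\<lambda>xs. F (rev xs))"
  unfolding multilinear_def by simp

end

section \<open>The transposed action and the transposed differential\<close>
locale leibniz_character = graded_leibniz_algebra scale V br
  for scale :: "'k::field \<Rightarrow> 'v::ab_group_add \<Rightarrow> 'v" (infixr \<open>*s\<close> 75)
    and V :: "int \<Rightarrow> 'v set" and br :: "'v \<Rightarrow> 'v \<Rightarrow> 'v" +
  fixes \<epsilon> :: "'v \<Rightarrow> 'k"
  assumes character: "nonunital_lie_character scale V br \<epsilon>"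
begin

lemma br_linear_left: "br (c *s v + w) u = c *s br v u + br w u"
  using linear_left[of u] by (simp add: Vector_Spaces.linear_def module_hom_iff)

lemma br_linear_right: "br u (c *s v + w) = c *s br u v + br u w"
  using linear_right[of u] by (simp add: Vector_Spaces.linear_def module_hom_iff)

lemma character_linear: "\<epsilon> (c *s v + w) = c * \<epsilon> v + \<epsilon> w"
  using character by (simp add: nonunital_lie_character_def Vector_Spaces.linear_def module_hom_iff)

lemma character_degree: "v \<in> V m \<Longrightarrow> m \<noteq> 0 \<Longrightarrow> \<epsilon> v = 0"
  using character by (auto simp add: nonunital_lie_character_def)

lemma character_br [simp]: "\<epsilon> (br v w) = 0"
  using character by (auto simp add: nonunital_lie_character_def)

text \<open>
  The transpose of \<open>R\<^sub>w\<close>: the value of \<open>F\<close> at \<open>R\<^sub>w\<close> of the word stored in \<open>rs\<close>.  Words are stored with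
  their last letter first, so that the recursion removing the last letter runs along the list.  The even part of \<open>w\<close>
  passes a letter unchanged, the odd part passes it with the sign of its parity.
\<close>
fun act :: "('v list \<Rightarrow> 'k) \<Rightarrow> 'v \<Rightarrow> 'v list \<Rightarrow> 'k" where
  "act F w [] = \<epsilon> w * F []"
| "act F w (v # rs) =
     act (\<lambda>us. F (v # us)) (even_part w) rs +
     act (\<lambda>us. F (parity_involution v # us)) (odd_part w) rs +
     F (br v w # rs)"

text \<open>
  The transpose of \<open>\<delta> (x w) = R\<^sub>w x - \<delta> x w\<close>, again on reversed words.
\<close>
fun codifferential :: "('v list \<Rightarrow> 'k) \<Rightarrow> 'v list \<Rightarrow> 'k" where
  "codifferential F [] = 0"
| "codifferential F (w # rs) = act F w rs - codifferential (\<lambda>us. F (w # us)) rs"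

lemma act_combination: "act (\<lambda>x. c * F x + H x) w rs = c * act F w rs + act H w rs"
  by (induction rs arbitrary: F H w) (simp_all add: algebra_simps)

lemma act_vector_linear:
  "multilinear F \<Longrightarrow> act F (c *s u + w) rs = c * act F u rs + act F w rs"
  by (induction rs arbitrary: F u w)
    (simp_all add: character_linear even_part_linear odd_part_linear
      multilinear_slot br_linear_right multilinear_hd distrib_left distrib_right)

lemma multilinear_act: "multilinear F \<Longrightarrow> multilinear (act F w)"
proof -
  have "act F w (xs @ (c *s u + v) # ys) = c * act F w (xs @ u # ys) + act F w (xs @ v # ys)"
    if "multilinear F" for F w xs c u v ys
    using that
  proof (induction xs arbitrary: F w)
    case Nil
    then show ?case
      by (simp add: multilinear_hd parity_involution_linear br_linear_left act_combination
          distrib_left)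
  next
    case (Cons x xs)
    then show ?case
      using multilinearD[OF Cons.prems, of "br x w # xs"]
      by (simp add: multilinear_slot algebra_simps)
  qed
  then show "multilinear F \<Longrightarrow> multilinear (act F w)"
    unfolding multilinear_def[of "act F w"] by blast
qed

lemma codifferential_combination:
  "codifferential (\<lambda>x. c * F x + H x) rs = c * codifferential F rs + codifferential H rs"
  by (induction rs arbitrary: F H) (simp_all add: act_combination right_diff_distrib)

lemma multilinear_codifferential: "multilinear F \<Longrightarrow> multilinear (codifferential F)"
proof -
  have "codifferential F (xs @ (c *s u + v) # ys) =
      c * codifferential F (xs @ u # ys) + codifferential F (xs @ v # ys)"
    if "multilinear F" for F xs c u v ys
    using that
  proof (induction xs arbitrary: F)
    case Nil
    then show ?case
      by (simp add: multilinear_hd act_vector_linear codifferential_combination right_diff_distrib)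
  next
    case (Cons x xs)
    then show ?case
      using multilinearD[OF multilinear_act[OF Cons.prems, of x]]
      by (simp add: multilinear_slot algebra_simps)
  qed
  then show "multilinear F \<Longrightarrow> multilinear (codifferential F)"
    unfolding multilinear_def[of "codifferential F"] by blast
qed

lemma act_zero: "multilinear F \<Longrightarrow> act F 0 rs = 0"
  by (metis act_vector_linear[of F 1 0 0 rs] add_0 add_cancel_right_right mult_1 scale_one)

text \<open>
  For homogeneous letters only one of the two parity terms survives, and it carries the sign.
\<close>
lemma act_homogeneous:
  assumes F: "multilinear F" and w: "w \<in> V b" and v: "v \<in> V d"
  shows "act F w (v # rs) = sign (b * d) * act (\<lambda>us. F (v # us)) w rs + F (br v w # rs)"
proof -
  have "(\<lambda>us. F (sign d *s v # us)) = (\<lambda>us. sign d * F (v # us) + 0)"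
    using multilinear_scale[OF F, of "[]"] by simp
  moreover have "act (\<lambda>us. sign d * F (v # us) + 0) w rs =
      sign d * act (\<lambda>us. F (v # us)) w rs + act (\<lambda>_. 0) w rs"
    by (rule act_combination)
  moreover have "act (\<lambda>_. 0) w rs = 0" for w
    by (induction rs arbitrary: w) auto
  ultimately show ?thesis
    using act_zero[OF multilinear_slot[OF F], of v] act_zero[OF multilinear_slot[OF F], of "sign d *s v"]
    by (cases "even b"; cases "even d")
      (simp_all add: even_part_homogeneous[OF w] odd_part_homogeneous[OF w]
        parity_involution_homogeneous[OF v] sign_even sign_odd)
qed

text \<open>
  The same as an equation between functionals, which can be rewritten inside another operator.
\<close>
lemma act_slot:
  assumes "multilinear F" and "w \<in> V b" and "v \<in> V d"
  shows "(\<lambda>us. act F w (v # us)) =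
    (\<lambda>us. sign (b * d) * act (\<lambda>us. F (v # us)) w us + F (br v w # us))"
  using act_homogeneous[OF assms] by blast

text \<open>
  The transposed form of \<open>R\<^sub>w R\<^sub>u = \<plusminus> R\<^sub>u R\<^sub>w + R\<close> with the last \<open>R\<close> taken at \<open>[u, w]\<close>.  For the last
  letter \<open>v\<close> of a word, the mixed terms, in which one operator acts on \<open>v\<close> and the other on the remaining
  word, are equal on both sides, and comparing the terms in which both act on \<open>v\<close> gives the Leibniz
  identity.
\<close>
lemma act_representation:
  assumes "multilinear F" and "u \<in> V a" and "w \<in> V b" and "homogeneous V ds rs"
  shows "act (act F w) u rs = sign (a * b) * act (act F u) w rs + act F (br u w) rs"
  using assms(4,1) unfolding homogeneous_def
proof (induction arbitrary: F rule: list_all2_induct)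
  case Nil
  (* A nontrivial sign needs a and b odd, and then the character kills u and w. *)
  show ?case
  proof (cases "a = 0 \<and> b = 0")
    case True
    then show ?thesis by (simp add: sign_even)
  next
    case False
    then have "\<epsilon> u = 0 \<or> \<epsilon> w = 0" using assms character_degree by blast
    then show ?thesis by auto
  qed
next
  case (Cons d ds v rs)
  note F = \<open>multilinear F\<close> and v = \<open>v \<in> V d\<close> and u = \<open>u \<in> V a\<close> and w = \<open>w \<in> V b\<close>
  let ?Fv = "\<lambda>us. F (v # us)"
  have L: "F (br v (br u w) # rs) = F (br (br v u) w # rs) - sign (b * a) * F (br (br v w) u # rs)"
    using multilinear_hd[OF F, of "- sign (b * a)" "br (br v w) u" "br (br v u) w" rs]
    by (simp add: leibniz[OF v u w])
  have IH: "act (act ?Fv w) u rs = sign (a * b) * act (act ?Fv u) w rs + act ?Fv (br u w) rs"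
    by (rule Cons.IH[OF multilinear_slot[OF F]])
  have "act (act F w) u (v # rs) =
      sign (a * d) * (sign (b * d) * act (act ?Fv w) u rs + act (\<lambda>us. F (br v w # us)) u rs) +
      (sign (b * (d + a)) * act (\<lambda>us. F (br v u # us)) w rs + F (br (br v u) w # rs))"
    by (simp add: act_homogeneous[OF multilinear_act[OF F] u v] act_slot[OF F w v]
        act_combination act_homogeneous[OF F w degree[OF v u]] del: act.simps)
  moreover have "act (act F u) w (v # rs) =
      sign (b * d) * (sign (a * d) * act (act ?Fv u) w rs + act (\<lambda>us. F (br v u # us)) w rs) +
      (sign (a * (d + b)) * act (\<lambda>us. F (br v w # us)) u rs + F (br (br v w) u # rs))"
    by (simp add: act_homogeneous[OF multilinear_act[OF F] w v] act_slot[OF F u v]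
        act_combination act_homogeneous[OF F u degree[OF v w]] del: act.simps)
  moreover have "act F (br u w) (v # rs) =
      sign ((a + b) * d) * act ?Fv (br u w) rs + F (br v (br u w) # rs)"
    by (rule act_homogeneous[OF F degree[OF u w] v])
  ultimately show ?case
    by (simp add: L IH sign_add distrib_left distrib_right mult.commute mult.left_commute
      del: act.simps)
qed

text \<open>
  The terms of the two sides that contain \<open>R\<^sub>u\<close>, for the last letter \<open>u\<close>, agree by
  \<open>act_representation\<close>; the other ones agree by induction.
\<close>
lemma codifferential_act:
  assumes "multilinear F" and "w \<in> V b" and "homogeneous V ds rs"
  shows "act (codifferential F) w rs = codifferential (act F w) rs"
  using assms(3,1) unfolding homogeneous_def
proof (induction arbitrary: F rule: list_all2_induct)
  case Nil
  show ?case by simp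
next
  case (Cons a ds u rs)
  note F = \<open>multilinear F\<close> and u = \<open>u \<in> V a\<close> and w = \<open>w \<in> V b\<close>
  let ?Fu = "\<lambda>us. F (u # us)"
  have slot: "(\<lambda>us. codifferential F (u # us)) = (\<lambda>us. (-1) * codifferential ?Fu us + act F u us)"
    by auto
  have "act (codifferential F) w (u # rs) =
      sign (b * a) * act (\<lambda>us. codifferential F (u # us)) w rs + codifferential F (br u w # rs)"
    by (rule act_homogeneous[OF multilinear_codifferential[OF F] w u])
  also have "\<dots> = sign (b * a) * (- codifferential (act ?Fu w) rs + act (act F u) w rs) +
      (act F (br u w) rs - codifferential (\<lambda>us. F (br u w # us)) rs)"
    by (subst slot, subst act_combination) (simp add: Cons.IH[OF multilinear_slot[OF F]])
  finally have L: "act (codifferential F) w (u # rs) = \<dots>" .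
  have R: "codifferential (act F w) (u # rs) = act (act F w) u rs -
      (sign (b * a) * codifferential (act ?Fu w) rs + codifferential (\<lambda>us. F (br u w # us)) rs)"
    by (simp only: codifferential.simps act_slot[OF F w u] codifferential_combination)
  show ?case
    unfolding L R act_representation[OF F u w Cons.hyps(2)[folded homogeneous_def]]
    by (simp add: algebra_simps)
qed

lemma codifferential_squared:
  assumes "multilinear F" and "homogeneous V ds rs"
  shows "codifferential (codifferential F) rs = 0"
  using assms(2,1) unfolding homogeneous_def
proof (induction arbitrary: F rule: list_all2_induct)
  case Nil
  show ?case by simp
next
  case (Cons b ds w rs)
  note F = \<open>multilinear F\<close>
  have slot: "(\<lambda>us. codifferential F (w # us)) =
      (\<lambda>us. (-1) * codifferential (\<lambda>us. F (w # us)) us + act F w us)"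
    by auto
  have "codifferential (codifferential F) (w # rs) =
      act (codifferential F) w rs - codifferential (\<lambda>us. codifferential F (w # us)) rs"
    by (rule codifferential.simps(2))
  also have "\<dots> = act (codifferential F) w rs - codifferential (act F w) rs"
    by (subst slot, subst codifferential_combination) (simp add: Cons.IH[OF multilinear_slot[OF F]])
  finally have "codifferential (codifferential F) (w # rs) = \<dots>" .
  then show ?case
    using codifferential_act[OF F \<open>w \<in> V b\<close> Cons.hyps(2)[folded homogeneous_def]] by simp
qed

end

section \<open>Zero tensors are detected by multilinear functionals\<close>
definition pairing :: "('v list \<Rightarrow> 'k::field) \<Rightarrow> ('k, 'v) formal \<Rightarrow> 'k" where
  "pairing F f = (\<Sum>xs\<in>Poly_Mapping.keys f. Poly_Mapping.lookup f xs * F xs)"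

lemma pairing_superset:
  assumes "finite S" and "Poly_Mapping.keys f \<subseteq> S"
  shows "pairing F f = (\<Sum>xs\<in>S. Poly_Mapping.lookup f xs * F xs)"
  unfolding pairing_def
  by (rule sum.mono_neutral_left) (use assms in \<open>auto simp: in_keys_iff\<close>)

lemma pairing_add: "pairing F (f + g) = pairing F f + pairing F g"
proof -
  let ?S = "Poly_Mapping.keys f \<union> Poly_Mapping.keys g"
  have "Poly_Mapping.keys (f + g) \<subseteq> ?S" by (rule keys_add)
  then show ?thesis
    by (simp add: pairing_superset[of ?S] lookup_add distrib_right sum.distrib)
qed

lemma pairing_fscale: "pairing F (fscale c f) = c * pairing F f"
proof -
  have "Poly_Mapping.keys (fscale c f) \<subseteq> Poly_Mapping.keys f" by (auto simp: in_keys_iff)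
  then show ?thesis
    by (simp add: pairing_superset[of "Poly_Mapping.keys f"] sum_distrib_left mult.assoc)
qed

lemma pairing_zero [simp]: "pairing F 0 = 0"
  by (simp add: pairing_def)

lemma pairing_diff: "pairing F (f - g) = pairing F f - pairing F g"
  using pairing_add[of F "f - g" g] by simp

lemma pairing_word [simp]: "pairing F (word xs) = F xs"
  by (simp add: pairing_def word_def)

lemma pairing_sum: "pairing F (\<Sum>i\<in>I. f i) = (\<Sum>i\<in>I. pairing F (f i))"
  by (induction I rule: infinite_finite_induct) (simp_all add: pairing_add)

lemma word_expansion: "f = (\<Sum>xs\<in>Poly_Mapping.keys f. fscale (Poly_Mapping.lookup f xs) (word xs))"
  by (rule poly_mapping_eqI)
    (auto simp: word_def lookup_sum lookup_single when_def in_keys_iff if_distrib cong: if_cong)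

context graded_vector_space
begin

abbreviation relations :: "nat \<Rightarrow> ('k, 'v) formal set" where
  "relations \<equiv> multilinear_relations scale"

lemma relation_combination:
  assumes "length xs + 1 + length ys = n"
  shows "word (xs @ (c *s v + w) # ys) - (fscale c (word (xs @ v # ys)) + word (xs @ w # ys))
    \<in> formal.span (relations n)"
proof -
  have "word (xs @ (c *s v + w) # ys) - word (xs @ (c *s v) # ys) - word (xs @ w # ys) \<in> relations n"
    and "word (xs @ (c *s v) # ys) - fscale c (word (xs @ v # ys)) \<in> relations n"
    using assms unfolding multilinear_relations_def by blast+
  from formal.span_add[OF this[THEN formal.span_base]] show ?thesis
    by (simp add: algebra_simps)
qed

lemma pairing_relations:
  assumes "multilinear F" and "f \<in> formal.span (relations n)"
  shows "pairing F f = 0"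
  using assms(2)
proof (induction rule: formal.span_induct)
  case base
  show ?case by (auto simp: formal.subspace_def pairing_add pairing_fscale)
next
  case (step f)
  then show ?case
    using assms(1)
    by (auto simp: multilinear_relations_def pairing_diff pairing_fscale multilinear_add
        multilinear_scale)
qed

text \<open>
  A combination outside the span of the relations is separated from it by a linear functional.
  On words of length \<open>n\<close> such a functional is a multilinear form, because it kills the relations.
\<close>
lemma relations_if_pairing_zero:
  assumes f: "f \<in> formal_power n" and zero: "\<And>F. multilinear F \<Longrightarrow> pairing F f = 0"
  shows "f \<in> formal.span (relations n)"
proof (rule ccontr)
  interpret functional: vector_space_pair fscale "(*) :: 'k \<Rightarrow> 'k \<Rightarrow> 'k"
    by unfold_locales (simp_all add: algebra_simps)
  assume notin: "f \<notin> formal.span (relations n)"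
  obtain B where B: "B \<subseteq> relations n" "formal.independent B" "relations n \<subseteq> formal.span B"
    using formal.maximal_independent_subset by blast
  have "f \<notin> formal.span B"
    using notin formal.span_mono[OF B(1)] by blast
  then have "f \<notin> B" and ind: "formal.independent (insert f B)"
    using formal.span_base[of f B] formal.independent_insertI[of f B] B(2) by auto
  obtain g where g: "Vector_Spaces.linear fscale (*) g"
      and val: "\<forall>x\<in>insert f B. g x = (if x = f then 1 else 0)"
    using functional.linear_independent_extend[OF ind, of "\<lambda>x. if x = f then 1 else 0"]
    by blast
  interpret g: Vector_Spaces.linear fscale "(*)" g by (rule g)
  have gR: "g x = 0" if "x \<in> formal.span (relations n)" for x
  proof -
    have "x \<in> formal.span B"
      using that formal.span_minimal[OF B(3)] by auto
    then show ?thesis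
    proof (induction rule: formal.span_induct)
      case base
      show ?case by (auto simp: formal.subspace_def g.add g.scale g.zero)
    qed (use val \<open>f \<notin> B\<close> in auto)
  qed
  (* Extension by zero to other lengths makes F satisfy the multilinearity equation everywhere. *)
  define F where "F xs = (if length xs = n then g (word xs) else 0)" for xs
  have "multilinear F"
    unfolding multilinear_def
  proof (intro allI)
    fix xs c v w ys
    show "F (xs @ (c *s v + w) # ys) = c * F (xs @ v # ys) + F (xs @ w # ys)"
      using gR[OF relation_combination[of xs ys n c v w]]
      by (simp add: F_def g.diff g.add g.scale)
  qed
  moreover have "pairing F f = g f"
  proof -
    have "g f = (\<Sum>xs\<in>Poly_Mapping.keys f. Poly_Mapping.lookup f xs * g (word xs))"
      by (subst word_expansion[of f]) (simp add: g.sum g.scale)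
    also have "\<dots> = pairing F f"
      unfolding pairing_def using f by (intro sum.cong) (auto simp: F_def formal_power_def)
    finally show ?thesis by simp
  qed
  ultimately show False using zero val by simp
qed

section \<open>Homogeneous words generate the tensor power\<close>
definition homogeneous_words :: "nat \<Rightarrow> ('k, 'v) formal set" where
  "homogeneous_words n = {word vs | vs ds. length vs = n \<and> homogeneous V ds vs}"

text \<open>
  The letters are replaced by sums of homogeneous ones from the right to the left: \<open>ys\<close> is the
  suffix that is already homogeneous.
\<close>
lemma word_in_span_homogeneous:
  assumes "homogeneous V ds ys" and "length xs + length ys = n"
  shows "word (xs @ ys) \<in> formal.span (homogeneous_words n \<union> relations n)" (is "_ \<in> ?W")
  using assms
proof (induction xs arbitrary: ds ys rule: rev_induct)
  case Nil
  then show ?case by (auto intro!: formal.span_base simp: homogeneous_words_def)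
next
  case (snoc v xs)
  let ?Q = "{u. word (xs @ u # ys) \<in> ?W}"
  have R: "formal.span (relations n) \<subseteq> ?W" by (rule formal.span_mono) simp
  have comb: "c *s u + w \<in> ?Q" if "u \<in> ?Q" "w \<in> ?Q" for c u w
  proof -
    have "word (xs @ (c *s u + w) # ys) - (fscale c (word (xs @ u # ys)) + word (xs @ w # ys)) \<in> ?W"
      using relation_combination[of xs ys n c u w] R snoc.prems by auto
    moreover have "fscale c (word (xs @ u # ys)) + word (xs @ w # ys) \<in> ?W"
      using that by (auto intro: formal.span_add formal.span_scale)
    ultimately show ?thesis using formal.span_add by fastforce
  qed
  have hom: "u \<in> ?Q" if "u \<in> V m" for u m
    using snoc.IH[of "m # ds" "u # ys"] snoc.prems that by (simp add: homogeneous_def)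
  have "subspace ?Q"
    unfolding subspace_def
    using comb[of _ _ 1] comb[of _ 0] hom[of 0 0] subspace_0[OF subspace_V] by auto
  moreover note decomposition = grade_decomposition_component[of v, unfolded grade_decomposition_def]
  ultimately have "(\<Sum>m | component v m \<noteq> 0. component v m) \<in> ?Q"
    using hom by (intro subspace_sum) auto
  then have "v \<in> ?Q" using decomposition by simp
  then show ?case by simp
qed

lemma formal_power_subset_span:
  assumes "f \<in> formal_power n"
  shows "f \<in> formal.span (homogeneous_words n \<union> relations n)"
proof -
  have "word xs \<in> formal.span (homogeneous_words n \<union> relations n)" if "length xs = n" for xs
    using word_in_span_homogeneous[of "[]" "[]" xs] that by (simp add: homogeneous_def)
  then show ?thesis
    using assms by (subst word_expansion)
      (intro formal.span_sum formal.span_scale, auto simp: formal_power_def)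
qed

end

section \<open>The explicit formula satisfies the recursion\<close>

lemma homogeneous_snocE:
  assumes "homogeneous V ds (vs @ [w])"
  obtains ds' e where "ds = ds' @ [e]" "homogeneous V ds' vs" "w \<in> V e"
  using assms unfolding homogeneous_def list_all2_append2 list_all2_Cons2
  by (metis list_all2_Nil2)

context leibniz_character
begin

text \<open>
  These are, up to the common sign, the terms of the differential of \<open>vs @ [w]\<close> that remove the letter \<open>w\<close>.
\<close>
lemma act_eq_sum:
  assumes "multilinear F" and "w \<in> V e" and "homogeneous V ds vs"
  shows "act (\<lambda>xs. F (rev xs)) w (rev vs) =
    (\<Sum>i\<in>{1..length vs}. sign (e * (\<Sum>k\<in>{i<..length vs}. ds ! (k - 1))) *
        F (vs[i - 1 := br (vs ! (i - 1)) w])) +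
    sign (e * (\<Sum>k\<in>{0<..length vs}. ds ! (k - 1))) * \<epsilon> w * F vs"
  using assms(1,3)
proof (induction vs arbitrary: F ds rule: rev_induct)
  case Nil
  then show ?case by (simp add: sign_def)
next
  case (snoc v vs)
  from snoc.prems(2) obtain ds' d where ds: "ds = ds' @ [d]" "homogeneous V ds' vs" "v \<in> V d"
    by (rule homogeneous_snocE)
  let ?n = "length vs" and ?F = "\<lambda>xs. F (xs @ [v])"
  note F = \<open>multilinear F\<close>
  have len: "length ds' = ?n" using ds(2) by (simp add: homogeneous_def list_all2_lengthD)
  have F': "multilinear ?F"
    using multilinear_rev[OF multilinear_slot[OF multilinear_rev[OF F], of v]] by simp
  have tail: "(\<Sum>k\<in>{i<..Suc ?n}. ds ! (k - 1)) = (\<Sum>k\<in>{i<..?n}. ds' ! (k - 1)) + d"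
    if "i \<le> ?n" for i
  proof -
    have "{i<..Suc ?n} = insert (Suc ?n) {i<..?n}" using that by auto
    moreover have "(\<Sum>k\<in>{i<..?n}. ds ! (k - 1)) = (\<Sum>k\<in>{i<..?n}. ds' ! (k - 1))"
      by (rule sum.cong) (auto simp: ds nth_append len)
    ultimately show ?thesis using len by (simp add: ds nth_append)
  qed
  have act: "act (\<lambda>xs. F (rev xs)) w (rev (vs @ [v])) =
      sign (e * d) * act (\<lambda>xs. ?F (rev xs)) w (rev vs) + F (vs @ [br v w])"
    using act_homogeneous[OF multilinear_rev[OF F] \<open>w \<in> V e\<close> ds(3), of "rev vs"] by simp
  have brackets: "(\<Sum>i\<in>{1..length (vs @ [v])}.
        sign (e * (\<Sum>k\<in>{i<..length (vs @ [v])}. ds ! (k - 1))) *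
        F ((vs @ [v])[i - 1 := br ((vs @ [v]) ! (i - 1)) w])) =
      sign (e * d) * (\<Sum>i\<in>{1..?n}. sign (e * (\<Sum>k\<in>{i<..?n}. ds' ! (k - 1))) *
        ?F (vs[i - 1 := br (vs ! (i - 1)) w])) + F (vs @ [br v w])"
  proof -
    have "sign (e * (\<Sum>k\<in>{i<..Suc ?n}. ds ! (k - 1))) *
          F ((vs @ [v])[i - 1 := br ((vs @ [v]) ! (i - 1)) w]) =
        sign (e * d) * (sign (e * (\<Sum>k\<in>{i<..?n}. ds' ! (k - 1))) *
          ?F (vs[i - 1 := br (vs ! (i - 1)) w]))" if "i \<in> {1..?n}" for i
    proof -
      have "i - 1 < ?n" using that by auto
      then show ?thesis
        using tail[of i] that
        by (simp add: sign_add distrib_left list_update_append nth_append mult_ac)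
    qed
    then show ?thesis
      by (simp add: sum_distrib_left sign_def)
  qed
  have "sign (e * (\<Sum>k\<in>{0<..length (vs @ [v])}. ds ! (k - 1))) =
      (sign (e * d) * sign (e * (\<Sum>k\<in>{0<..?n}. ds' ! (k - 1))) :: 'k)"
    using tail[of 0] by (simp add: sign_add distrib_left mult_ac)
  then show ?case
    unfolding act brackets snoc.IH[OF F' ds(2)] by (simp add: algebra_simps)
qed

definition boundary :: "int list \<Rightarrow> 'v list \<Rightarrow> ('k, 'v) formal" where
  "boundary ds vs = bracket_sum br ds vs + character_sum \<epsilon> ds vs"

lemma pairs_eq_Sigma:
  "(\<Sum>(i, j)\<in>{(i, j). 1 \<le> i \<and> i < j \<and> j \<le> (n::nat)}. h i j) = (\<Sum>j\<in>{1..n}. \<Sum>i\<in>{1..<j}. h i j)"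
proof -
  have "(\<Sum>j\<in>{1..n}. \<Sum>i\<in>{1..<j}. h i j) = (\<Sum>(j, i)\<in>Sigma {1..n} (\<lambda>j. {1..<j}). h i j)"
    by (rule sum.Sigma) auto
  also have "\<dots> = (\<Sum>(i, j)\<in>{(i, j). 1 \<le> i \<and> i < j \<and> j \<le> n}. h i j)"
    by (rule sum.reindex_bij_witness[of _ "\<lambda>(i, j). (j, i)" "\<lambda>(j, i). (i, j)"]) auto
  finally show ?thesis by simp
qed

lemma pairing_boundary:
  "pairing F (boundary ds vs) =
    (\<Sum>j\<in>{1..length vs}.
      (\<Sum>i\<in>{1..<j}. sign (int j - 1 + alpha ds i j) *
         F (omit j (vs[i - 1 := br (vs ! (i - 1)) (vs ! (j - 1))]))) +
      sign (int j - 1 + alpha ds 0 j) * \<epsilon> (vs ! (j - 1)) * F (omit j vs))"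
  by (simp only: boundary_def bracket_sum_def character_sum_def pairing_add pairing_sum
      prod.case_distrib[of "pairing F"] pairing_fscale pairing_word pairs_eq_Sigma sum.distrib)

text \<open>
  The pairs with \<open>j\<close> at most the length of \<open>vs\<close> do not see the last letter; the remaining ones, in
  which \<open>j\<close> is the position of \<open>w\<close>, are summed up by \<open>act_eq_sum\<close>.
\<close>
lemma pairing_boundary_snoc:
  assumes "multilinear F" and "w \<in> V e" and "homogeneous V ds vs"
  shows "pairing F (boundary (ds @ [e]) (vs @ [w])) =
    pairing (\<lambda>xs. F (xs @ [w])) (boundary ds vs) +
    (-1) ^ length vs * act (\<lambda>xs. F (rev xs)) w (rev vs)"
proof -
  let ?n = "length vs"
  have len: "length ds = ?n" using assms(3) by (simp add: homogeneous_def list_all2_lengthD)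
  have alpha: "alpha (ds @ [e]) i j = alpha ds i j" if "1 \<le> j" "j \<le> ?n" for i j
  proof -
    have "(\<Sum>k\<in>{i<..<j}. (ds @ [e]) ! (k - 1)) = (\<Sum>k\<in>{i<..<j}. ds ! (k - 1))"
      by (rule sum.cong) (use that len in \<open>auto simp: nth_append\<close>)
    then show ?thesis using that len by (auto simp: alpha_def nth_append)
  qed
  have alpha_last: "alpha (ds @ [e]) i (Suc ?n) = e * (\<Sum>k\<in>{i<..?n}. ds ! (k - 1))" for i
  proof -
    have "(\<Sum>k\<in>{i<..<Suc ?n}. (ds @ [e]) ! (k - 1)) = (\<Sum>k\<in>{i<..?n}. ds ! (k - 1))"
      by (rule sum.cong) (use len in \<open>auto simp: nth_append\<close>)
    then show ?thesis using len by (auto simp: alpha_def nth_append)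
  qed
  have omit: "omit j (xs @ [w]) = omit j xs @ [w]" if "1 \<le> j" "j \<le> length xs" for j xs
    using that by (simp add: omit_def)
  have omit_last: "omit (Suc (length xs)) (xs @ [u]) = xs" for xs :: "'v list" and u
    by (simp add: omit_def)
  have n: "sign (int ?n + x) = (-1) ^ ?n * sign x" for x
    by (simp add: sign_add) (simp add: sign_def)
  let ?term = "\<lambda>ds vs F j. (\<Sum>i\<in>{1..<j}. sign (int j - 1 + alpha ds i j) *
         F (omit j (vs[i - 1 := br (vs ! (i - 1)) (vs ! (j - 1))]))) +
      sign (int j - 1 + alpha ds 0 j) * \<epsilon> (vs ! (j - 1)) * F (omit j vs)"
  have "?term (ds @ [e]) (vs @ [w]) F j = ?term ds vs (\<lambda>xs. F (xs @ [w])) j"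
    if "j \<in> {1..?n}" for j
    using that
    by (intro arg_cong2[where f = "(+)"] sum.cong refl)
      (auto simp: alpha nth_append list_update_append omit)
  then have "(\<Sum>j\<in>{1..?n}. ?term (ds @ [e]) (vs @ [w]) F j) =
      pairing (\<lambda>xs. F (xs @ [w])) (boundary ds vs)"
    unfolding pairing_boundary by (rule sum.cong[OF refl])
  moreover have "?term (ds @ [e]) (vs @ [w]) F (Suc ?n) =
      (-1) ^ ?n * act (\<lambda>xs. F (rev xs)) w (rev vs)"
  proof -
    have "(\<Sum>i\<in>{1..<Suc ?n}. sign (int (Suc ?n) - 1 + alpha (ds @ [e]) i (Suc ?n)) *
        F (omit (Suc ?n) ((vs @ [w])[i - 1 := br ((vs @ [w]) ! (i - 1)) ((vs @ [w]) ! (Suc ?n - 1))]))) =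
      (\<Sum>i\<in>{1..?n}. (-1) ^ ?n * (sign (e * (\<Sum>k\<in>{i<..?n}. ds ! (k - 1))) *
        F (vs[i - 1 := br (vs ! (i - 1)) w])))"
    proof (rule sum.cong)
      fix i assume "i \<in> {1..?n}"
      then have "(vs @ [w])[i - 1 := br ((vs @ [w]) ! (i - 1)) ((vs @ [w]) ! (Suc ?n - 1))] =
          vs[i - 1 := br (vs ! (i - 1)) w] @ [w]"
        by (auto simp: nth_append list_update_append)
      then show "sign (int (Suc ?n) - 1 + alpha (ds @ [e]) i (Suc ?n)) *
        F (omit (Suc ?n) ((vs @ [w])[i - 1 := br ((vs @ [w]) ! (i - 1)) ((vs @ [w]) ! (Suc ?n - 1))])) =
        (-1) ^ ?n * (sign (e * (\<Sum>k\<in>{i<..?n}. ds ! (k - 1))) *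
        F (vs[i - 1 := br (vs ! (i - 1)) w]))"
        using omit_last[of "vs[i - 1 := br (vs ! (i - 1)) w]" w] by (simp add: alpha_last n)
    qed auto
    then show ?thesis
      unfolding act_eq_sum[OF assms]
      by (simp add: alpha_last omit_last n sum_distrib_left distrib_left mult.assoc)
  qed
  ultimately show ?thesis
    unfolding pairing_boundary[of F "ds @ [e]"] by simp
qed

text \<open>
  The transpose of the differential on words of length \<open>n\<close> in their usual order.  The power of
  \<open>-1\<close> undoes the passage from \<open>d\<close> to \<open>\<delta>\<close>.
\<close>
definition coboundary :: "nat \<Rightarrow> ('v list \<Rightarrow> 'k) \<Rightarrow> 'v list \<Rightarrow> 'k" where
  "coboundary n F xs = (-1) ^ (n + 1) * codifferential (\<lambda>us. F (rev us)) (rev xs)"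

lemma multilinear_coboundary: "multilinear F \<Longrightarrow> multilinear (coboundary n F)"
  using multilinear_combination[of "\<lambda>xs. codifferential (\<lambda>us. F (rev us)) (rev xs)" "\<lambda>_. 0" "(-1) ^ (n + 1)"]
    multilinear_rev[OF multilinear_codifferential[OF multilinear_rev]]
  by (simp add: coboundary_def[abs_def] multilinear_def)

lemma pairing_boundary_eq_coboundary:
  assumes "multilinear F" and "homogeneous V ds vs"
  shows "pairing F (boundary ds vs) = coboundary (length vs) F vs"
  using assms
proof (induction vs arbitrary: F ds rule: rev_induct)
  case Nil
  then show ?case by (simp add: pairing_boundary coboundary_def)
next
  case (snoc w vs)
  from snoc.prems(2) obtain ds' e where ds: "ds = ds' @ [e]" "homogeneous V ds' vs" "w \<in> V e"
    by (rule homogeneous_snocE)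
  note F = \<open>multilinear F\<close>
  have F': "multilinear (\<lambda>xs. F (xs @ [w]))"
    using multilinear_rev[OF multilinear_slot[OF multilinear_rev[OF F], of w]] by simp
  show ?case
    using snoc.IH[OF F' ds(2)]
    by (simp add: ds(1) pairing_boundary_snoc[OF F ds(3,2)] coboundary_def algebra_simps)
qed

lemma coboundary_squared:
  assumes "multilinear F" and "homogeneous V ds vs"
  shows "coboundary n (coboundary m F) vs = 0"
proof -
  let ?G = "\<lambda>us. F (rev us)"
  have "homogeneous V (rev ds) (rev vs)" using assms(2) by (simp add: homogeneous_def)
  then have "codifferential (codifferential ?G) (rev vs) = 0"
    by (rule codifferential_squared[OF multilinear_rev[OF assms(1)]])
  moreover have "codifferential (\<lambda>us. c * codifferential ?G us) rs =
      c * codifferential (codifferential ?G) rs" for c rs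
  proof -
    have "act (\<lambda>_. 0) w rs = 0" for w rs
      by (induction rs arbitrary: w) auto
    then have "codifferential (\<lambda>_. 0) rs = 0"
      by (induction rs) auto
    then show ?thesis
      using codifferential_combination[of c "codifferential ?G" "\<lambda>_. 0" rs] by simp
  qed
  ultimately show ?thesis
    unfolding coboundary_def by (simp only: rev_rev_ident mult_zero_right)
qed

end

section \<open>The differential on tensors\<close>

lemma sum_list_omit:
  fixes ds :: "'a::ab_group_add list"
  assumes "1 \<le> j" and "j \<le> length ds"
  shows "sum_list (omit j ds) = sum_list ds - ds ! (j - 1)"
  using assms arg_cong[OF id_take_nth_drop[of "j - 1" ds], of sum_list] by (simp add: omit_def algebra_simps)

lemma sum_list_update_group:
  fixes ds :: "'a::ab_group_add list"
  shows "i < length ds \<Longrightarrow> sum_list (ds[i := x]) = sum_list ds + x - ds ! i"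
  by (induction ds arbitrary: i) (auto simp: algebra_simps split: nat.split)

lemma homogeneous_omit: "homogeneous V ds vs \<Longrightarrow> homogeneous V (omit j ds) (omit j vs)"
  by (simp add: homogeneous_def omit_def list_all2_appendI)

context leibniz_character
begin

text \<open>
  A bracket term keeps the total degree, since the bracket adds the degrees of its arguments.  A character
  term either removes a letter of degree zero or has coefficient zero.
\<close>
lemma boundary_in_component:
  assumes "homogeneous V ds vs"
  shows "boundary ds vs \<in> formal.span {word us | us es.
    length us = length vs - 1 \<and> homogeneous V es us \<and> sum_list es = sum_list ds}" (is "_ \<in> formal.span ?W")
  unfolding boundary_def
proof (rule formal.span_add)
  have len: "length ds = length vs" using assms by (simp add: homogeneous_def list_all2_lengthD)
  have nth: "vs ! (i - 1) \<in> V (ds ! (i - 1))" if "1 \<le> i" "i \<le> length vs" for i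
    using assms that by (simp add: homogeneous_def list_all2_conv_all_nth)
  have word_bracket: "word (omit j (vs[i - 1 := br (vs ! (i - 1)) (vs ! (j - 1))])) \<in> ?W"
    if ij: "1 \<le> i" "i < j" "j \<le> length vs" for i j
  proof -
    let ?vs = "vs[i - 1 := br (vs ! (i - 1)) (vs ! (j - 1))]"
    let ?ds = "ds[i - 1 := ds ! (i - 1) + ds ! (j - 1)]"
    have "br (vs ! (i - 1)) (vs ! (j - 1)) \<in> V (ds ! (i - 1) + ds ! (j - 1))"
      using nth ij by (intro degree) auto
    then have "homogeneous V ?ds ?vs"
      using assms by (simp add: homogeneous_def list_all2_update_cong)
    then have "homogeneous V (omit j ?ds) (omit j ?vs)" by (rule homogeneous_omit)
    moreover have "sum_list (omit j ?ds) = sum_list ds"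
      using ij len sum_list_update_group[of "i - 1" ds "ds ! (i - 1) + ds ! (j - 1)"]
      by (simp add: sum_list_omit)
    moreover have "length (omit j ?vs) = length vs - 1"
      using ij by (simp add: omit_def)
    ultimately show ?thesis by blast
  qed
  show "bracket_sum br ds vs \<in> formal.span ?W"
    unfolding bracket_sum_def
  proof (rule formal.span_sum, clarify)
    fix i j assume "1 \<le> i" "i < j" "j \<le> length vs"
    then show "fscale (sign (int j - 1 + alpha ds i j))
        (word (omit j (vs[i - 1 := br (vs ! (i - 1)) (vs ! (j - 1))]))) \<in> formal.span ?W"
      by (intro formal.span_scale formal.span_base word_bracket)
  qed
  show "character_sum \<epsilon> ds vs \<in> formal.span ?W"
    unfolding character_sum_def
  proof (rule formal.span_sum)
    fix j assume j: "j \<in> {1..length vs}"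
    show "fscale (sign (int j - 1 + alpha ds 0 j) * \<epsilon> (vs ! (j - 1))) (word (omit j vs)) \<in> formal.span ?W"
    proof (cases "ds ! (j - 1) = 0")
      case True
      then have "sum_list (omit j ds) = sum_list ds"
        using j len by (simp add: sum_list_omit)
      moreover have "length (omit j vs) = length vs - 1"
        using j by (auto simp: omit_def min_def)
      ultimately have "word (omit j vs) \<in> ?W"
        using homogeneous_omit[OF assms, of j] by blast
      then show ?thesis by (intro formal.span_scale formal.span_base)
    next
      case False
      then have "\<epsilon> (vs ! (j - 1)) = 0" using character_degree nth j by auto
      then show ?thesis by (simp add: formal.span_zero)
    qed
  qed
qed

lemma boundary_in_formal_power:
  assumes "homogeneous V ds vs"
  shows "boundary ds vs \<in> formal_power (length vs - 1)"
proof -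
  have "formal.span {word us | us es.
    length us = length vs - 1 \<and> homogeneous V es us \<and> sum_list es = sum_list ds} \<subseteq>
    formal_power (length vs - 1)"
    by (rule formal.span_minimal)
      (auto simp: formal.subspace_def formal_power_zero formal_power_add formal_power_scale
        formal_power_word)
  then show ?thesis using boundary_in_component[OF assms] by blast
qed

text \<open>
  The differential as a relation between representatives, characterized by its transpose.
  It determines \<open>g\<close> up to the multilinearity relations, and it is compatible with linear combinations
  without any choice of \<open>g\<close>.
\<close>
definition is_boundary :: "nat \<Rightarrow> ('k, 'v) formal \<Rightarrow> ('k, 'v) formal \<Rightarrow> bool" where
  "is_boundary n f g \<longleftrightarrow>
     (\<forall>F. multilinear F \<longrightarrow> pairing F g = pairing (coboundary n F) f)"

lemma is_boundary_zero: "is_boundary n 0 0"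
  by (simp add: is_boundary_def)

lemma is_boundary_add: "is_boundary n f g \<Longrightarrow> is_boundary n f' g' \<Longrightarrow> is_boundary n (f + f') (g + g')"
  by (simp add: is_boundary_def pairing_add)

lemma is_boundary_scale: "is_boundary n f g \<Longrightarrow> is_boundary n (fscale c f) (fscale c g)"
  by (simp add: is_boundary_def pairing_fscale)

text \<open>
  Here multilinearity of \<open>coboundary n F\<close> enters: this is why the differential is well defined.
\<close>
lemma is_boundary_relations: "f \<in> formal.span (relations n) \<Longrightarrow> is_boundary m f 0"
  by (simp add: is_boundary_def pairing_relations[OF multilinear_coboundary])

lemma is_boundary_word:
  "homogeneous V ds vs \<Longrightarrow> is_boundary (length vs) (word vs) (boundary ds vs)"
  by (simp add: is_boundary_def pairing_boundary_eq_coboundary)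

lemma is_boundary_span:
  assumes f: "f \<in> formal.span S" and W: "formal.subspace W"
    and S: "\<And>s. s \<in> S \<Longrightarrow> \<exists>g\<in>W. is_boundary n s g"
  shows "\<exists>g\<in>W. is_boundary n f g"
  using f
proof (induction rule: formal.span_induct)
  case base
  show ?case
  proof (unfold formal.subspace_def, intro conjI ballI allI; clarsimp)
    show "\<exists>g\<in>W. is_boundary n 0 g"
      using is_boundary_zero formal.subspace_0[OF W] by blast
  next
    fix f g f' g'
    assume "g \<in> W" "is_boundary n f g" "g' \<in> W" "is_boundary n f' g'"
    then show "\<exists>h\<in>W. is_boundary n (f + f') h"
      using is_boundary_add formal.subspace_add[OF W] by blast
  next
    fix c f g
    assume "g \<in> W" "is_boundary n f g"
    then show "\<exists>h\<in>W. is_boundary n (fscale c f) h"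
      using is_boundary_scale formal.subspace_scale[OF W] by blast
  qed
next
  case (step s)
  then show ?case using S by simp
qed

lemma subspace_formal_power: "formal.subspace (formal_power n)"
  by (simp add: formal.subspace_def formal_power_zero formal_power_add formal_power_scale)

text \<open>
  The explicit formula provides a boundary for homogeneous words, and these generate.
\<close>
lemma boundary_exists:
  assumes "f \<in> formal_power n"
  shows "\<exists>g\<in>formal_power (n - 1). is_boundary n f g"
proof (rule is_boundary_span[OF formal_power_subset_span[OF assms] subspace_formal_power])
  fix s assume "s \<in> homogeneous_words n \<union> relations n"
  then show "\<exists>g\<in>formal_power (n - 1). is_boundary n s g"
  proof
    assume "s \<in> homogeneous_words n"
    then show ?thesis
      unfolding homogeneous_words_def using is_boundary_word boundary_in_formal_power by blast
  next
    assume "s \<in> relations n"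
    then show ?thesis
      using is_boundary_relations[OF formal.span_base] formal_power_zero by blast
  qed
qed

text \<open>
  The set of all boundaries of the representatives of \<open>A\<close>; by the next lemma it is a single coset.
\<close>
definition differential :: "nat \<Rightarrow> ('k, 'v) tensor \<Rightarrow> ('k, 'v) tensor" where
  "differential n A = {g \<in> formal_power (n - 1). \<forall>f\<in>A. is_boundary n f g}"

lemma differential_class:
  assumes f: "f \<in> formal_power n" and g: "g \<in> formal_power (n - 1)" and fg: "is_boundary n f g"
  shows "differential n (tensor_class scale n f) = tensor_class scale (n - 1) g"
proof (intro equalityI subsetI)
  fix g' assume "g' \<in> differential n (tensor_class scale n f)"
  then have g': "g' \<in> formal_power (n - 1)" "is_boundary n f g'"
    using tensor_class_self[OF f] by (auto simp: differential_def)
  then have "g - g' \<in> formal_power (n - 1)"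
    using g formal.subspace_diff[OF subspace_formal_power] by blast
  then have "g - g' \<in> formal.span (relations (n - 1))"
    by (rule relations_if_pairing_zero) (use fg g'(2) in \<open>simp add: is_boundary_def pairing_diff\<close>)
  then show "g' \<in> tensor_class scale (n - 1) g"
    using g g' by (simp add: tensor_class_def tensor_rel_def)
next
  fix g' assume "g' \<in> tensor_class scale (n - 1) g"
  then have g': "g' \<in> formal_power (n - 1)" "g - g' \<in> formal.span (relations (n - 1))"
    by (auto dest: tensor_classD)
  have "is_boundary n f' g'" if "f' \<in> tensor_class scale n f" for f'
    unfolding is_boundary_def
  proof (intro allI impI)
    fix F assume F: "multilinear F"
    have "pairing (coboundary n F) (f - f') = 0"
      using that by (intro pairing_relations[OF multilinear_coboundary[OF F]]) (auto dest: tensor_classD)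
    moreover have "pairing F (g - g') = 0" by (rule pairing_relations[OF F g'(2)])
    ultimately show "pairing F g' = pairing (coboundary n F) f'"
      using fg F by (simp add: is_boundary_def pairing_diff)
  qed
  then show "g' \<in> differential n (tensor_class scale n f)"
    using g' by (simp add: differential_def)
qed

lemma tensor_powerE:
  assumes "A \<in> tensor_power scale n"
  obtains f where "f \<in> formal_power n" "A = tensor_class scale n f"
  using assms unfolding tensor_power_def tensor_class_def by (auto elim: quotientE)

lemma tensor_class_in_power: "f \<in> formal_power n \<Longrightarrow> tensor_class scale n f \<in> tensor_power scale n"
  by (simp add: tensor_power_def tensor_class_def quotientI)

lemma differentialE:
  assumes "A \<in> tensor_power scale n"
  obtains f g where "f \<in> formal_power n" "g \<in> formal_power (n - 1)" "is_boundary n f g"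
    "A = tensor_class scale n f" "differential n A = tensor_class scale (n - 1) g"
proof -
  from assms obtain f where f: "f \<in> formal_power n" "A = tensor_class scale n f"
    by (rule tensor_powerE)
  from boundary_exists[OF f(1)] obtain g where "g \<in> formal_power (n - 1)" "is_boundary n f g"
    by blast
  with f show thesis
    by (intro that) (simp_all add: differential_class)
qed

lemma tensor_linear_differential: "tensor_linear scale n (n - 1) (differential n)"
  unfolding tensor_linear_def
proof (intro conjI ballI allI)
  fix A assume "A \<in> tensor_power scale n"
  then obtain f g where A: "f \<in> formal_power n" "g \<in> formal_power (n - 1)" "is_boundary n f g"
    "A = tensor_class scale n f" "differential n A = tensor_class scale (n - 1) g"
    by (rule differentialE)
  then show "differential n A \<in> tensor_power scale (n - 1)"
    by (simp add: tensor_class_in_power)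
  show "differential n (tensor_scale scale n c A) = tensor_scale scale (n - 1) c (differential n A)" for c
    unfolding A(5) tensor_scale_class[OF A(2)] unfolding A(4) tensor_scale_class[OF A(1)]
    by (rule differential_class[OF formal_power_scale formal_power_scale is_boundary_scale, OF A(1-3)])
  fix B assume "B \<in> tensor_power scale n"
  then obtain f' g' where B: "f' \<in> formal_power n" "g' \<in> formal_power (n - 1)" "is_boundary n f' g'"
    "B = tensor_class scale n f'" "differential n B = tensor_class scale (n - 1) g'"
    by (rule differentialE)
  show "differential n (tensor_add scale n A B) =
      tensor_add scale (n - 1) (differential n A) (differential n B)"
    unfolding A(5) B(5) tensor_add_class[OF A(2) B(2)] unfolding A(4) B(4) tensor_add_class[OF A(1) B(1)]
    by (rule differential_class[OF formal_power_add formal_power_add is_boundary_add,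
          OF A(1) B(1) A(2) B(2) A(3) B(3)])
qed

lemma differential_component:
  "differential n ` tensor_component scale V n m \<subseteq> tensor_component scale V (n - 1) m"
proof
  let ?W = "\<lambda>n. formal.span {word vs | vs ds. length vs = n \<and> homogeneous V ds vs \<and> sum_list ds = m}"
  have sub: "?W n \<subseteq> formal_power n" for n
    by (rule formal.span_minimal[OF _ subspace_formal_power]) (auto simp: formal_power_word)
  fix B assume "B \<in> differential n ` tensor_component scale V n m"
  then obtain f where f: "f \<in> ?W n" and B: "B = differential n (tensor_class scale n f)"
    by (auto simp: tensor_component_def)
  have "\<exists>g\<in>?W (n - 1). is_boundary n f g"
    using f formal.subspace_span
  proof (rule is_boundary_span)
    fix s :: "('k, 'v) formal"
    assume "s \<in> {word vs | vs ds. length vs = n \<and> homogeneous V ds vs \<and> sum_list ds = m}"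
    then show "\<exists>g\<in>?W (n - 1). is_boundary n s g"
      using is_boundary_word boundary_in_component by blast
  qed
  then obtain g where g: "g \<in> ?W (n - 1)" "is_boundary n f g" by blast
  then have "B = tensor_class scale (n - 1) g"
    unfolding B using f sub by (intro differential_class) auto
  then show "B \<in> tensor_component scale V (n - 1) m"
    using g(1) by (simp add: tensor_component_def)
qed

lemma differential_squared:
  assumes "A \<in> tensor_power scale n"
  shows "differential (n - 1) (differential n A) = tensor_zero scale (n - 2)"
proof -
  from assms obtain f g where A: "f \<in> formal_power n" "g \<in> formal_power (n - 1)" "is_boundary n f g"
    "A = tensor_class scale n f" "differential n A = tensor_class scale (n - 1) g"
    by (rule differentialE)
  have "is_boundary (n - 1) g 0"
    unfolding is_boundary_def
  proof (intro allI impI)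
    fix F assume F: "multilinear F"
    have "pairing (coboundary n (coboundary (n - 1) F)) f = 0"
      using formal_power_subset_span[OF A(1)]
    proof (induction rule: formal.span_induct)
      case base
      show ?case by (auto simp: formal.subspace_def pairing_add pairing_fscale)
    next
      case (step s)
      then show ?case
      proof
        assume "s \<in> homogeneous_words n"
        then show ?thesis
          using coboundary_squared[OF F] by (auto simp: homogeneous_words_def)
      next
        assume "s \<in> relations n"
        then show ?thesis
          using pairing_relations[OF _ formal.span_base] multilinear_coboundary F by blast
      qed
    qed
    then show "pairing F 0 = pairing (coboundary (n - 1) F) g"
      using A(3) multilinear_coboundary[OF F] by (simp add: is_boundary_def)
  qed
  then show ?thesis
    using differential_class[OF A(2) formal_power_zero]
    by (simp add: A(5) tensor_zero_def numeral_2_eq_2)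
qed

lemma differential_is_tensor_differential: "tensor_differential scale V differential"
  using tensor_linear_differential differential_component differential_squared
  by (simp add: tensor_differential_def)

lemma differential_pure_tensor:
  assumes "homogeneous V ds vs"
  shows "differential (length vs) (pure_tensor scale vs) =
    tensor_class scale (length vs - 1) (bracket_sum br ds vs + character_sum \<epsilon> ds vs)"
  unfolding pure_tensor_def boundary_def[symmetric]
  using assms by (intro differential_class formal_power_word boundary_in_formal_power is_boundary_word) simp_all

end

section \<open>Unital and non-unital Leibniz algebras\<close>

lemma (in graded_leibniz_algebra) leibniz_character_zero: "leibniz_character scale V br (\<lambda>_. 0)"
proof (intro leibniz_character.intro leibniz_character_axioms.intro graded_leibniz_algebra_axioms)
  have "Vector_Spaces.linear scale (*) (\<lambda>_. 0)"
    by unfold_locales (simp_all add: algebra_simps)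
  then show "nonunital_lie_character scale V br (\<lambda>_. 0)"
    by (simp add: nonunital_lie_character_def)
qed

theorem proposition5p12:
  fixes scale :: "'k::field \<Rightarrow> 'v::ab_group_add \<Rightarrow> 'v"
    and V :: "int \<Rightarrow> 'v set"
    and br :: "'v \<Rightarrow> 'v \<Rightarrow> 'v"
    and \<nu> :: "'k \<Rightarrow> 'v"
    and \<epsilon> :: "'v \<Rightarrow> 'k"
  shows "(graded_unital_leibniz_algebra scale V br \<nu> \<and> lie_character scale V br \<nu> \<epsilon> \<longrightarrow>
            (\<exists>d. tensor_differential scale V d \<and>
                 (\<forall>n>0. \<forall>ds vs. length vs = n \<and> homogeneous V ds vs \<longrightarrow>
                    d n (pure_tensor scale vs) =
                      tensor_class scale (n - 1) (bracket_sum br ds vs + character_sum \<epsilon> ds vs))))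
       \<and> (graded_leibniz_algebra scale V br \<and> nonunital_lie_character scale V br \<epsilon> \<longrightarrow>
            (\<exists>d. tensor_differential scale V d \<and>
                 (\<forall>n>0. \<forall>ds vs. length vs = n \<and> homogeneous V ds vs \<longrightarrow>
                    d n (pure_tensor scale vs) =
                      tensor_class scale (n - 1) (bracket_sum br ds vs))))"
proof (intro conjI impI)
  assume "graded_unital_leibniz_algebra scale V br \<nu> \<and> lie_character scale V br \<nu> \<epsilon>"
  then have char: "leibniz_character scale V br \<epsilon>"
    by (simp add: leibniz_character_def leibniz_character_axioms_def
        graded_unital_leibniz_algebra_def lie_character_def)
  show "\<exists>d. tensor_differential scale V d \<and>
      (\<forall>n>0. \<forall>ds vs. length vs = n \<and> homogeneous V ds vs \<longrightarrow>
        d n (pure_tensor scale vs) =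
          tensor_class scale (n - 1) (bracket_sum br ds vs + character_sum \<epsilon> ds vs))"
    using leibniz_character.differential_is_tensor_differential[OF char]
      leibniz_character.differential_pure_tensor[OF char] by blast
next
  assume "graded_leibniz_algebra scale V br \<and> nonunital_lie_character scale V br \<epsilon>"
  then have char: "leibniz_character scale V br (\<lambda>_. 0)"
    by (simp add: graded_leibniz_algebra.leibniz_character_zero)
  have "bracket_sum br ds vs + character_sum (\<lambda>_. 0) ds vs = (bracket_sum br ds vs :: ('k, 'v) formal)"
    for ds vs
    by (simp add: character_sum_def)
  note pure = leibniz_character.differential_pure_tensor[OF char, unfolded this]
  show "\<exists>d. tensor_differential scale V d \<and>
      (\<forall>n>0. \<forall>ds vs. length vs = n \<and> homogeneous V ds vs \<longrightarrow>
        d n (pure_tensor scale vs) = tensor_class scale (n - 1) (bracket_sum br ds vs))"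
    using leibniz_character.differential_is_tensor_differential[OF char] pure by blast
qed

end
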